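(* Let $K$ be an algebraically closed field of arbitrary characteristic and let $0\neq f\in\langle x,y\rangle\subset K[[x,y]]$. If $f$ is Newton non-degenerate (NND), then $f$ is inner Newton non-degenerate with respect to $\Gamma(f)$, i.e. $f$ is inner non-degenerate (IND) along each inner face of the Newton diagram $\Gamma(f)$.
   Context: Write $f=\sum_\alpha a_\alpha x^{\alpha_1}y^{\alpha_2}$, $\operatorname{supp}(f)=\{\alpha\mid a_\alpha\neq 0\}$. The Newton diagram $\Gamma(f)$ is the union of the compact faces (vertices and edges) of the convex hull $\Gamma_+(f)$ of $\bigcup_{\alpha\in\operatorname{supp}(f)}(\alpha+\mathbb{R}_{\geq0}^2)$. For a face $\Delta$ put $\operatorname{in}_\Delta(f)=\sum_{\alpha\in\Delta}a_\alpha x^{\alpha_1}y^{\alpha_2}$. $f$ is non-degenerate (ND) along $\Delta$ if the partial derivatives of $\operatorname{in}_\Delta(f)$ have no common zero in $(K^* )^2$. $f$ is NND if it is ND along every face (of any dimension) of $\Gamma(f)$; $f$ is not required to be convenient. A face is inner if it is not contained in a coordinate axis. For $q=(q_1,q_2)\in K^2$ let $H_q\subseteq\mathbb{R}^2$ be the coordinate subspace of all points whose $i$-th coordinate is $0$ for each $i$ with $q_i=0$ (so $H_q=\mathbb{R}^2$ if $q\in(K^* )^2$). $f$ is IND along $\Delta$ if for each common zero $q\in K^2$ of the partial derivatives of $\operatorname{in}_\Delta(f)$ the face $\Delta$ contains no point of $H_q$. *)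

theory Defs
  imports "HOL-Analysis.Analysis" "HOL-Computational_Algebra.Computational_Algebra"
begin

text \<open>
  \<open>K[[x,y]]\<close> is \<open>K[[x]][[y]]\<close>, the type \<open>'a fps fps\<close>, and \<open>K[x,y]\<close> is \<open>K[x][y]\<close>, the type
  \<open>'a poly poly\<close>: the outer variable is \<open>y\<close>, the inner one is \<open>x\<close>.
\<close>

definition coeff2 :: "'a::zero fps fps \<Rightarrow> nat \<times> nat \<Rightarrow> 'a" where
  "coeff2 f \<alpha> = fps_nth (fps_nth f (snd \<alpha>)) (fst \<alpha>)"

definition ideal_xy :: "'a::comm_ring_1 fps fps set" where
  "ideal_xy = {fps_const fps_X * g + fps_X * h | g h. True}"

definition supp :: "'a::zero fps fps \<Rightarrow> (nat \<times> nat) set" where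
  "supp f = {\<alpha>. coeff2 f \<alpha> \<noteq> 0}"

definition lattice_point :: "nat \<times> nat \<Rightarrow> real \<times> real" where
  "lattice_point \<alpha> = (real (fst \<alpha>), real (snd \<alpha>))"

definition newton_polyhedron :: "'a::zero fps fps \<Rightarrow> (real \<times> real) set" where
  "newton_polyhedron f =
     convex hull (\<Union>\<alpha>\<in>supp f. {lattice_point \<alpha> + v | v. fst v \<ge> 0 \<and> snd v \<ge> 0})"

text \<open>
  \<^const>\<open>face_of\<close> also counts the empty set and the whole set as faces. The former is excluded
  explicitly; the latter is unbounded for \<open>f \<noteq> 0\<close>, so that only vertices and edges remain.
\<close>
definition newton_diagram_faces :: "'a::zero fps fps \<Rightarrow> (real \<times> real) set set" where
  "newton_diagram_faces f =
     {\<Delta>. \<Delta> face_of newton_polyhedron f \<and> compact \<Delta> \<and> \<Delta> \<noteq> {}}"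

text \<open>Intended for bounded \<open>\<Delta>\<close> only, which contains finitely many exponents.\<close>
definition initial_form :: "(real \<times> real) set \<Rightarrow> 'a::comm_ring_1 fps fps \<Rightarrow> 'a poly poly" where
  "initial_form \<Delta> f =
     (\<Sum>\<alpha> | \<alpha> \<in> supp f \<and> lattice_point \<alpha> \<in> \<Delta>. monom (monom (coeff2 f \<alpha>) (fst \<alpha>)) (snd \<alpha>))"

definition eval2 :: "'a::comm_ring_1 poly poly \<Rightarrow> 'a \<times> 'a \<Rightarrow> 'a" where
  "eval2 p q = poly (poly p [:snd q:]) (fst q)"

definition pderiv_x :: "'a::idom poly poly \<Rightarrow> 'a poly poly" where
  "pderiv_x p = map_poly pderiv p"

definition pderiv_y :: "'a::idom poly poly \<Rightarrow> 'a poly poly" where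
  "pderiv_y p = pderiv p"

definition partials_common_zero :: "'a::idom poly poly \<Rightarrow> 'a \<times> 'a \<Rightarrow> bool" where
  "partials_common_zero p q \<longleftrightarrow> eval2 (pderiv_x p) q = 0 \<and> eval2 (pderiv_y p) q = 0"

definition ND :: "'a::idom fps fps \<Rightarrow> (real \<times> real) set \<Rightarrow> bool" where
  "ND f \<Delta> \<longleftrightarrow>
     \<not> (\<exists>q. fst q \<noteq> 0 \<and> snd q \<noteq> 0 \<and> partials_common_zero (initial_form \<Delta> f) q)"

definition NND :: "'a::idom fps fps \<Rightarrow> bool" where
  "NND f \<longleftrightarrow> (\<forall>\<Delta>\<in>newton_diagram_faces f. ND f \<Delta>)"

definition inner_face :: "(real \<times> real) set \<Rightarrow> bool" where
  "inner_face \<Delta> \<longleftrightarrow> \<not> \<Delta> \<subseteq> {v. fst v = 0} \<and> \<not> \<Delta> \<subseteq> {v. snd v = 0}"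

definition coord_subspace :: "'a::zero \<times> 'a \<Rightarrow> (real \<times> real) set" where
  "coord_subspace q = {v. (fst q = 0 \<longrightarrow> fst v = 0) \<and> (snd q = 0 \<longrightarrow> snd v = 0)}"

definition IND :: "'a::idom fps fps \<Rightarrow> (real \<times> real) set \<Rightarrow> bool" where
  "IND f \<Delta> \<longleftrightarrow>
     (\<forall>q. partials_common_zero (initial_form \<Delta> f) q \<longrightarrow> \<Delta> \<inter> coord_subspace q = {})"

definition INND_newton_diagram :: "'a::idom fps fps \<Rightarrow> bool" where
  "INND_newton_diagram f \<longleftrightarrow> (\<forall>\<Delta>\<in>newton_diagram_faces f. inner_face \<Delta> \<longrightarrow> IND f \<Delta>)"

end

(* Let q be a common zero of the partials of the initial form along a face \<Delta>. If \<Delta> meets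
   H_q, then \<Delta> \<inter> H_q is again a compact face, because the Newton polyhedron lies in the
   closed quadrant. Replace each zero coordinate of q by 1 to get a point q' of the torus. The
   monomials of the initial form along \<Delta> \<inter> H_q do not involve the variables that vanish
   at q, and all other monomials vanish at q; hence both partials of this smaller initial form
   vanish at q', which contradicts non-degeneracy along \<Delta> \<inter> H_q. *)
theory Submission
  imports Defs
begin

lemma eval2_sum: "eval2 (sum g A) q = (\<Sum>\<alpha>\<in>A. eval2 (g \<alpha>) q)"
  by (simp add: eval2_def poly_sum)

lemma eval2_monom: "eval2 (monom (monom c i) j) q = c * fst q ^ i * snd q ^ j"
  by (simp add: eval2_def poly_monom)

lemma pderiv_sum: "pderiv (sum g A) = (\<Sum>\<alpha>\<in>A. pderiv (g \<alpha>))"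
  by (induction A rule: infinite_finite_induct) (simp_all add: pderiv_add)

lemma pderiv_x_sum: "pderiv_x (sum g A) = (\<Sum>\<alpha>\<in>A. pderiv_x (g \<alpha>))"
proof (rule poly_eqI)
  fix n
  have "pderiv (\<Sum>\<alpha>\<in>A. coeff (g \<alpha>) n) = (\<Sum>\<alpha>\<in>A. pderiv (coeff (g \<alpha>) n))"
    by (rule pderiv_sum)
  then show "coeff (pderiv_x (sum g A)) n = coeff (\<Sum>\<alpha>\<in>A. pderiv_x (g \<alpha>)) n"
    by (simp add: pderiv_x_def coeff_map_poly coeff_sum)
qed

lemma pderiv_x_monom: "pderiv_x (monom (monom c i) j) = monom (monom (of_nat i * c) (i - 1)) j"
  by (simp add: pderiv_x_def map_poly_monom pderiv_monom)

lemma pderiv_y_sum: "pderiv_y (sum g A) = (\<Sum>\<alpha>\<in>A. pderiv_y (g \<alpha>))"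
  by (simp add: pderiv_y_def pderiv_sum)

lemma pderiv_y_monom: "pderiv_y (monom (monom c i) j) = monom (monom (of_nat j * c) i) (j - 1)"
  by (simp add: pderiv_y_def pderiv_monom of_nat_poly smult_monom)

text \<open>The truncated exponent \<open>fst \<alpha> - 1\<close> is harmless: where it differs
  from the true one, at \<open>fst \<alpha> = 0\<close>, the factor
  \<open>of_nat (fst \<alpha>)\<close> is zero.\<close>

lemma eval2_pderiv_x_initial_form:
  "eval2 (pderiv_x (initial_form \<Delta> f)) q =
    (\<Sum>\<alpha> | \<alpha> \<in> supp f \<and> lattice_point \<alpha> \<in> \<Delta>.
       of_nat (fst \<alpha>) * coeff2 f \<alpha> * fst q ^ (fst \<alpha> - 1) * snd q ^ snd \<alpha>)"
  by (simp add: initial_form_def pderiv_x_sum pderiv_x_monom eval2_sum eval2_monom)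

lemma eval2_pderiv_y_initial_form:
  "eval2 (pderiv_y (initial_form \<Delta> f)) q =
    (\<Sum>\<alpha> | \<alpha> \<in> supp f \<and> lattice_point \<alpha> \<in> \<Delta>.
       of_nat (snd \<alpha>) * coeff2 f \<alpha> * fst q ^ fst \<alpha> * snd q ^ (snd \<alpha> - 1))"
  by (simp add: initial_form_def pderiv_y_sum pderiv_y_monom eval2_sum eval2_monom)

lemma newton_polyhedron_nonneg:
  assumes "v \<in> newton_polyhedron f"
  shows "fst v \<ge> 0" and "snd v \<ge> 0"
proof -
  have "convex ({0..} \<times> {0..} :: (real \<times> real) set)"
    by (intro convex_Times convex_real_interval)
  then have "newton_polyhedron f \<subseteq> {0..} \<times> {0..}"
    unfolding newton_polyhedron_def
    by (intro hull_minimal) (auto simp: lattice_point_def)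
  then show "fst v \<ge> 0" and "snd v \<ge> 0"
    using assms by auto
qed

text \<open>Nonnegative coordinates have sum zero only if each is zero, so a single supporting
  functional cuts out all the equations of \<open>coord_subspace q\<close>.\<close>

lemma coord_subspace_face_of_newton_polyhedron:
  "newton_polyhedron f \<inter> coord_subspace q face_of newton_polyhedron f"
proof -
  \<comment> \<open>Pairing with \<open>a\<close> adds up the coordinates at which \<open>q\<close>
    vanishes. For \<open>q\<close> in the torus \<open>a\<close> is zero and the face is the whole
    polyhedron.\<close>
  define a :: "real \<times> real" where "a = (of_bool (fst q = 0), of_bool (snd q = 0))"
  have "newton_polyhedron f \<inter> {v. a \<bullet> v = 0} face_of newton_polyhedron f"
  proof (rule face_of_Int_supporting_hyperplane_ge)
    show "convex (newton_polyhedron f)"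
      by (simp add: newton_polyhedron_def)
    show "a \<bullet> v \<ge> 0" if "v \<in> newton_polyhedron f" for v
      using newton_polyhedron_nonneg[OF that] by (simp add: a_def inner_prod_def)
  qed
  moreover have "newton_polyhedron f \<inter> {v. a \<bullet> v = 0} = newton_polyhedron f \<inter> coord_subspace q"
    using newton_polyhedron_nonneg[of _ f]
    by (auto simp: a_def inner_prod_def coord_subspace_def add_nonneg_eq_0_iff)
  ultimately show ?thesis
    by simp
qed

lemma closed_coord_subspace: "closed (coord_subspace q)"
proof -
  have "closed {v :: real \<times> real. fst v = 0}" "closed {v :: real \<times> real. snd v = 0}"
    by (intro closed_Collect_eq continuous_on_fst continuous_on_snd
        continuous_on_id continuous_on_const)+
  then show ?thesis
    by (cases "fst q = 0"; cases "snd q = 0") (simp_all add: coord_subspace_def closed_Collect_conj)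
qed

lemma newton_diagram_faces_Int_coord_subspace:
  assumes "\<Delta> \<in> newton_diagram_faces f" and "\<Delta> \<inter> coord_subspace q \<noteq> {}"
  shows "\<Delta> \<inter> coord_subspace q \<in> newton_diagram_faces f"
proof -
  have \<Delta>: "\<Delta> face_of newton_polyhedron f" "compact \<Delta>"
    using assms(1) by (auto simp: newton_diagram_faces_def)
  have "\<Delta> \<inter> (newton_polyhedron f \<inter> coord_subspace q) face_of newton_polyhedron f"
    using \<Delta>(1) coord_subspace_face_of_newton_polyhedron by (rule face_of_Int)
  moreover have "\<Delta> \<inter> (newton_polyhedron f \<inter> coord_subspace q) = \<Delta> \<inter> coord_subspace q"
    using face_of_imp_subset[OF \<Delta>(1)] by blast
  ultimately show ?thesis
    using \<Delta>(2) assms(2) closed_coord_subspace[of q]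
    by (simp add: newton_diagram_faces_def compact_Int_closed)
qed

text \<open>Makes the sum defining the initial form along a compact face finite, so that vanishing
  terms may be dropped from it.\<close>

lemma finite_lattice_points_bounded:
  assumes "bounded \<Delta>"
  shows "finite {\<alpha>. lattice_point \<alpha> \<in> \<Delta>}"
proof -
  obtain B where B: "\<And>v. v \<in> \<Delta> \<Longrightarrow> norm v \<le> B"
    using assms by (auto simp: bounded_iff)
  have "fst \<alpha> \<le> nat \<lfloor>B\<rfloor> \<and> snd \<alpha> \<le> nat \<lfloor>B\<rfloor>" if "lattice_point \<alpha> \<in> \<Delta>" for \<alpha>
  proof -
    have "real (fst \<alpha>) \<le> B" "real (snd \<alpha>) \<le> B"
      using B[OF that] norm_fst_le[of "real (fst \<alpha>)" "real (snd \<alpha>)"]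
        norm_snd_le[of "real (snd \<alpha>)" "real (fst \<alpha>)"]
      by (simp_all add: lattice_point_def)
    then show ?thesis
      by (simp add: le_nat_floor)
  qed
  then have "{\<alpha>. lattice_point \<alpha> \<in> \<Delta>} \<subseteq> {..nat \<lfloor>B\<rfloor>} \<times> {..nat \<lfloor>B\<rfloor>}"
    by auto
  then show ?thesis
    by (rule finite_subset) simp
qed

lemma partials_common_zero_Int_coord_subspace:
  fixes q :: "'a::idom \<times> 'a"
  assumes "bounded \<Delta>" and zero: "partials_common_zero (initial_form \<Delta> f) q"
  defines "q' \<equiv> (if fst q = 0 then 1 else fst q, if snd q = 0 then 1 else snd q)"
  shows "partials_common_zero (initial_form (\<Delta> \<inter> coord_subspace q) f) q'"
proof -
  let ?A = "{\<alpha>. \<alpha> \<in> supp f \<and> lattice_point \<alpha> \<in> \<Delta>}"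
  let ?B = "{\<alpha>. \<alpha> \<in> supp f \<and> lattice_point \<alpha> \<in> \<Delta> \<inter> coord_subspace q}"
  have fin: "finite ?A"
    using finite_lattice_points_bounded[OF assms(1)] by (rule rev_finite_subset) auto
  have "eval2 (pderiv_x (initial_form (\<Delta> \<inter> coord_subspace q) f)) q' = 0"
  proof (cases "fst q = 0")
    \<comment> \<open>Every exponent on the smaller face has first coordinate 0, so its initial form
      is free of x and each term carries the factor \<open>of_nat 0\<close>.\<close>
    case True
    then show ?thesis
      unfolding eval2_pderiv_x_initial_form
      by (intro sum.neutral) (auto simp: coord_subspace_def lattice_point_def)
  next
    case False
    \<comment> \<open>An exponent of \<open>\<Delta>\<close> outside \<open>coord_subspace q\<close>
      can only occur if \<open>snd q = 0\<close>, and then it has a positive power of y, which the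
      x-derivative keeps and \<open>q\<close> kills. On the remaining terms \<open>snd q = 0\<close>
      forces y-exponent 0, and \<open>0 ^ 0 = 1\<close> agrees with the value at
      \<open>q'\<close>.\<close>
    have "eval2 (pderiv_x (initial_form (\<Delta> \<inter> coord_subspace q) f)) q' =
        eval2 (pderiv_x (initial_form \<Delta> f)) q"
      unfolding eval2_pderiv_x_initial_form using fin False
      by (intro sum.mono_neutral_cong_left)
        (auto simp: coord_subspace_def lattice_point_def q'_def)
    then show ?thesis
      using zero by (simp add: partials_common_zero_def)
  qed
  moreover have "eval2 (pderiv_y (initial_form (\<Delta> \<inter> coord_subspace q) f)) q' = 0"
  proof (cases "snd q = 0")
    case True
    then show ?thesis
      unfolding eval2_pderiv_y_initial_form
      by (intro sum.neutral) (auto simp: coord_subspace_def lattice_point_def)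
  next
    case False
    \<comment> \<open>Same comparison with the variables exchanged: the y-derivative keeps the power
      of x.\<close>
    have "eval2 (pderiv_y (initial_form (\<Delta> \<inter> coord_subspace q) f)) q' =
        eval2 (pderiv_y (initial_form \<Delta> f)) q"
      unfolding eval2_pderiv_y_initial_form using fin False
      by (intro sum.mono_neutral_cong_left)
        (auto simp: coord_subspace_def lattice_point_def q'_def)
    then show ?thesis
      using zero by (simp add: partials_common_zero_def)
  qed
  ultimately show ?thesis
    by (simp add: partials_common_zero_def)
qed

theorem proposition4p3:
  fixes f :: "'a::alg_closed_field fps fps"
  assumes "f \<noteq> 0" and "f \<in> ideal_xy" and "NND f"
  shows "INND_newton_diagram f"
  unfolding INND_newton_diagram_def IND_def
proof (intro ballI allI impI, rule ccontr)
  fix \<Delta> and q :: "'a \<times> 'a"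
  assume \<Delta>: "\<Delta> \<in> newton_diagram_faces f"
    and zero: "partials_common_zero (initial_form \<Delta> f) q"
    and meets: "\<Delta> \<inter> coord_subspace q \<noteq> {}"
  \<comment> \<open>\<open>NND\<close> covers faces of every dimension, hence also the case where an
    edge \<open>\<Delta>\<close> is cut down to an endpoint on an axis.\<close>
  have "ND f (\<Delta> \<inter> coord_subspace q)"
    using assms(3) newton_diagram_faces_Int_coord_subspace[OF \<Delta> meets] by (simp add: NND_def)
  have "bounded \<Delta>"
    using \<Delta> by (simp add: newton_diagram_faces_def compact_imp_bounded)
  define q' where "q' = (if fst q = 0 then 1 else fst q, if snd q = 0 then 1 else snd q)"
  have "partials_common_zero (initial_form (\<Delta> \<inter> coord_subspace q) f) q'"
    unfolding q'_def using \<open>bounded \<Delta>\<close> zero by (rule partials_common_zero_Int_coord_subspace)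
  moreover have "fst q' \<noteq> 0" "snd q' \<noteq> 0"
    by (simp_all add: q'_def)
  ultimately show False
    using \<open>ND f (\<Delta> \<inter> coord_subspace q)\<close> unfolding ND_def by blast
qed

end
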